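(* Let $n\in\{1,2,\dots\}$ and $k\in\{2,3,\dots\}$. For every $\vec\sigma=\langle\sigma_2,\dots,\sigma_k\rangle\in S_n^{k-1}$, the lattice $L_{\mathrm{EJ}}(\vec\sigma)$ is isomorphic to the lattice $L_{\mathrm{C}}(\vec\sigma^{-1})$, where $\vec\sigma^{-1}=\langle\sigma_2^{-1},\dots,\sigma_k^{-1}\rangle$.
   Context: $S_n$ denotes the set of permutations of $\{1,\dots,n\}$; permutations are composed from right to left, i.e. $(\alpha\circ\beta)(x)=\alpha(\beta(x))$. The Edelman-Jamison lattice $L_{\mathrm{EJ}}(\vec\sigma)$: given $\vec\sigma=\langle\sigma_2,\dots,\sigma_k\rangle\in S_n^{k-1}$, let $\sigma_1\in S_n$ be the identity permutation. Then $L_{\mathrm{EJ}}(\vec\sigma)$ is the subsemilattice of the powerset join-semilattice $\langle P(\{1,\dots,n\});\cup\rangle$ generated by the sets $\{\sigma_i(1),\dots,\sigma_i(j)\}$ with $i\in\{1,\dots,k\}$ and $j\in\{0,\dots,n\}$ (for $j=0$ this set is $\varnothing$). Ordered by inclusion, and since it contains $\varnothing$, it is a (finite) lattice. The coordinatized lattice $L_{\mathrm{C}}(\vec\pi)$: given $\vec\pi=\langle\pi_{12},\dots,\pi_{1k}\rangle\in S_n^{k-1}$, let $\pi_{11}$ be the identity permutation and put $\pi_{ij}=\pi_{1j}\circ\pi_{1i}^{-1}$ for $i,j\in\{1,\dots,k\}$. An eligible $\vec\pi$-tuple is a $k$-tuple $\vec x=\langle x_1,\dots,x_k\rangle\in\{0,1,\dots,n\}^k$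 such that $\pi_{ij}(x_i+1)\ge x_j+1$ holds for all $i,j\in\{1,\dots,k\}$ with $x_i<n$. $L_{\mathrm{C}}(\vec\pi)$ is the set of eligible $\vec\pi$-tuples with the componentwise order ($\vec x\le\vec y$ iff $x_i\le y_i$ for all $i\in\{1,\dots,k\}$). It contains $\langle n,\dots,n\rangle$ and is a meet-subsemilattice of the $k$-th direct power of the chain $\{0<1<\dots<n\}$, hence it is a lattice. In $L_{\mathrm{C}}(\vec\sigma^{-1})$ one takes $\pi_{1i}=\sigma_i^{-1}$ for $i\in\{2,\dots,k\}$. *)

theory Defs
  imports
    Complex_Main
    "HOL-Library.FuncSet"
    "HOL-Combinatorics.Permutations"
    "HOL-Algebra.Lattice"
begin

text \<open>
  A vector \<open>\<langle>\<sigma>\<^sub>2, \<dots>, \<sigma>\<^sub>k\<rangle>\<close> of permutations of \<open>{1..n}\<close> is a family \<open>\<sigma> :: nat \<Rightarrow> nat \<Rightarrow> nat\<close>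
  of which only the members with index in \<open>{2..k}\<close> matter; \<open>with_id\<close> puts the identity
  at index 1, so the values \<open>\<sigma> 0\<close>, \<open>\<sigma> 1\<close> and \<open>\<sigma> i\<close> for \<open>i > k\<close> are never used below.
\<close>

definition perm_vector :: "nat \<Rightarrow> nat \<Rightarrow> (nat \<Rightarrow> nat \<Rightarrow> nat) \<Rightarrow> bool" where
  "perm_vector n k \<sigma> \<longleftrightarrow> (\<forall>i\<in>{2..k}. \<sigma> i permutes {1..n})"

definition with_id :: "(nat \<Rightarrow> nat \<Rightarrow> nat) \<Rightarrow> nat \<Rightarrow> nat \<Rightarrow> nat" where
  "with_id \<sigma> = \<sigma>(1 := id)"

definition join_subsemilattice :: "nat \<Rightarrow> nat set set \<Rightarrow> bool" where
  "join_subsemilattice n T \<longleftrightarrow> T \<subseteq> Pow {1..n} \<and> (\<forall>A\<in>T. \<forall>B\<in>T. A \<union> B \<in> T)"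

definition EJ_generators :: "nat \<Rightarrow> nat \<Rightarrow> (nat \<Rightarrow> nat \<Rightarrow> nat) \<Rightarrow> nat set set" where
  "EJ_generators n k \<sigma> = {with_id \<sigma> i ` {1..j} | i j. i \<in> {1..k} \<and> j \<in> {0..n}}"

definition L_EJ :: "nat \<Rightarrow> nat \<Rightarrow> (nat \<Rightarrow> nat \<Rightarrow> nat) \<Rightarrow> nat set gorder" where
  "L_EJ n k \<sigma> =
     \<lparr>carrier = join_subsemilattice n hull EJ_generators n k \<sigma>,
      eq = (=),
      le = (\<subseteq>)\<rparr>"

text \<open>
  Below, \<open>\<pi> i\<close> is \<open>\<pi>\<^sub>1\<^sub>i\<close>, and \<open>pi2 \<pi> i j\<close> is \<open>\<pi>\<^sub>i\<^sub>j = \<pi>\<^sub>1\<^sub>j \<circ> \<pi>\<^sub>1\<^sub>i\<^sup>-\<^sup>1\<close>.  A permutation in the sense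
  of \<open>permutes\<close> is a bijection of the whole type \<open>nat\<close>, so \<open>inv\<close> is its inverse permutation.
\<close>

definition pi2 :: "(nat \<Rightarrow> nat \<Rightarrow> nat) \<Rightarrow> nat \<Rightarrow> nat \<Rightarrow> nat \<Rightarrow> nat" where
  "pi2 \<pi> i j = with_id \<pi> j \<circ> inv (with_id \<pi> i)"

text \<open>\<open>k\<close>-tuples are extensional functions on \<open>{1..k}\<close>, so that equal tuples are equal functions.\<close>

definition eligible :: "nat \<Rightarrow> nat \<Rightarrow> (nat \<Rightarrow> nat \<Rightarrow> nat) \<Rightarrow> (nat \<Rightarrow> nat) \<Rightarrow> bool" where
  "eligible n k \<pi> x \<longleftrightarrow>
     x \<in> {1..k} \<rightarrow>\<^sub>E {0..n} \<and>
     (\<forall>i\<in>{1..k}. \<forall>j\<in>{1..k}. x i < n \<longrightarrow> pi2 \<pi> i j (x i + 1) \<ge> x j + 1)"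

definition L_C :: "nat \<Rightarrow> nat \<Rightarrow> (nat \<Rightarrow> nat \<Rightarrow> nat) \<Rightarrow> (nat \<Rightarrow> nat) gorder" where
  "L_C n k \<pi> =
     \<lparr>carrier = {x. eligible n k \<pi> x},
      eq = (=),
      le = (\<lambda>x y. \<forall>i\<in>{1..k}. x i \<le> y i)\<rparr>"

text \<open>\<open>join_pres\<close> and \<open>meet_pres\<close> include the requirement that both structures are lattices.\<close>

definition lattice_isomorphic ::
    "('a, 'c) gorder_scheme \<Rightarrow> ('b, 'd) gorder_scheme \<Rightarrow> bool" where
  "lattice_isomorphic L M \<longleftrightarrow>
     (\<exists>f. bij_betw f (carrier L) (carrier M) \<and> join_pres L M f \<and> meet_pres L M f)"

end

(* Write rho_i for sigma_i, with rho_1 the identity. Since pi_ij = rho_j^-1 o rho_i, a tuple x is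
   eligible iff for every i with x_i < n the element rho_i(x_i + 1) lies outside the union U(x) of the
   sets rho_j{1..x_j}, that is, iff each x_i is the largest j <= n with rho_i{1..j} contained in U(x).
   Hence A |-> (max {j <= n. rho_i{1..j} is contained in A})_i and U are mutually inverse and monotone. *)
theory Submission
  imports Defs
begin

section \<open>Order isomorphisms of lattices\<close>

lemma order_iso_least_Upper:
  assumes bij: "bij_betw f (carrier L) (carrier M)"
    and le: "\<And>x y. x \<in> carrier L \<Longrightarrow> y \<in> carrier L \<Longrightarrow> f x \<sqsubseteq>\<^bsub>M\<^esub> f y \<longleftrightarrow> x \<sqsubseteq>\<^bsub>L\<^esub> y"
    and A: "A \<subseteq> carrier L"
    and s: "least L s (Upper L A)"
  shows "least M (f s) (Upper M (f ` A))"
proof -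
  have img: "f ` carrier L = carrier M"
    using bij by (rule bij_betw_imp_surj_on)
  have "f s \<in> Upper M (f ` A)"
    using A le s unfolding least_def Upper_def img[symmetric] by blast
  moreover have "f s \<sqsubseteq>\<^bsub>M\<^esub> u" if "u \<in> Upper M (f ` A)" for u
  proof -
    obtain t where t: "t \<in> carrier L" "u = f t"
      using \<open>u \<in> Upper M (f ` A)\<close> unfolding Upper_def img[symmetric] by blast
    then have "t \<in> Upper L A"
      using \<open>u \<in> Upper M (f ` A)\<close> A le unfolding Upper_def img[symmetric] by blast
    then show ?thesis
      using s le t unfolding least_def Upper_def by blast
  qed
  ultimately show ?thesis
    by (simp add: least_def)
qed

text \<open>Dual of the previous lemma: \<open>inv_gorder\<close> exchanges upper with lower bounds
  and least with greatest.\<close>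

lemma order_iso_greatest_Lower:
  assumes bij: "bij_betw f (carrier L) (carrier M)"
    and le: "\<And>x y. x \<in> carrier L \<Longrightarrow> y \<in> carrier L \<Longrightarrow> f x \<sqsubseteq>\<^bsub>M\<^esub> f y \<longleftrightarrow> x \<sqsubseteq>\<^bsub>L\<^esub> y"
    and A: "A \<subseteq> carrier L"
    and s: "greatest L s (Lower L A)"
  shows "greatest M (f s) (Lower M (f ` A))"
  using order_iso_least_Upper[of f "inv_gorder L" "inv_gorder M" A s] assms by simp

text \<open>The join is a chosen least upper bound, so uniqueness of least elements identifies it
  with any given one.\<close>

lemma (in upper_semilattice) join_eqI:
  assumes "least L s (Upper L {x, y})" "x \<in> carrier L" "y \<in> carrier L"
  shows "x \<squnion> y = s"
  by (rule joinI) (use assms least_unique in metis)+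

lemma (in lower_semilattice) meet_eqI:
  assumes "greatest L s (Lower L {x, y})" "x \<in> carrier L" "y \<in> carrier L"
  shows "x \<sqinter> y = s"
  by (rule meetI) (use assms greatest_unique in metis)+

text \<open>Every pair in \<open>M\<close> is the image of a pair in \<open>L\<close>, so the bounds
  that exist in \<open>L\<close> are carried over and make \<open>M\<close> a lattice as well. This
  spares a computation of joins of eligible tuples.\<close>

lemma order_iso_imp_lattice_isomorphic:
  assumes L: "lattice L" and M: "partial_order M"
    and bij: "bij_betw f (carrier L) (carrier M)"
    and le: "\<And>x y. x \<in> carrier L \<Longrightarrow> y \<in> carrier L \<Longrightarrow> f x \<sqsubseteq>\<^bsub>M\<^esub> f y \<longleftrightarrow> x \<sqsubseteq>\<^bsub>L\<^esub> y"
  shows "lattice_isomorphic L M"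
proof -
  interpret L: lattice L by (rule L)
  interpret M: partial_order M by (rule M)
  have img: "f ` carrier L = carrier M"
    using bij by (rule bij_betw_imp_surj_on)
  have lub: "least M (f s) (Upper M {f x, f y})"
    if "least L s (Upper L {x, y})" "x \<in> carrier L" "y \<in> carrier L" for s x y
    using order_iso_least_Upper[OF bij le, of "{x, y}" s] that by simp
  have glb: "greatest M (f s) (Lower M {f x, f y})"
    if "greatest L s (Lower L {x, y})" "x \<in> carrier L" "y \<in> carrier L" for s x y
    using order_iso_greatest_Lower[OF bij le, of "{x, y}" s] that by simp
  interpret M: lattice M
  proof
    fix u v assume "u \<in> carrier M" "v \<in> carrier M"
    then obtain x y where xy: "x \<in> carrier L" "y \<in> carrier L" "u = f x" "v = f y"
      using img by blast
    show "\<exists>s. least M s (Upper M {u, v})"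
      using L.sup_of_two_exists[OF xy(1,2)] lub xy by blast
    show "\<exists>s. greatest M s (Lower M {u, v})"
      using L.inf_of_two_exists[OF xy(1,2)] glb xy by blast
  qed
  have "f (x \<squnion>\<^bsub>L\<^esub> y) = f x \<squnion>\<^bsub>M\<^esub> f y" "f (x \<sqinter>\<^bsub>L\<^esub> y) = f x \<sqinter>\<^bsub>M\<^esub> f y"
    if xy: "x \<in> carrier L" "y \<in> carrier L" for x y
  proof -
    have fxy: "f x \<in> carrier M" "f y \<in> carrier M"
      using xy img by auto
    obtain s where s: "least L s (Upper L {x, y})"
      using L.sup_of_two_exists[OF xy] by blast
    show "f (x \<squnion>\<^bsub>L\<^esub> y) = f x \<squnion>\<^bsub>M\<^esub> f y"
      using L.join_eqI[OF s xy] M.join_eqI[OF lub[OF s xy] fxy] by simp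
    obtain t where t: "greatest L t (Lower L {x, y})"
      using L.inf_of_two_exists[OF xy] by blast
    show "f (x \<sqinter>\<^bsub>L\<^esub> y) = f x \<sqinter>\<^bsub>M\<^esub> f y"
      using L.meet_eqI[OF t xy] M.meet_eqI[OF glb[OF t xy] fxy] by simp
  qed
  then show ?thesis
    using bij L M.lattice_axioms unfolding lattice_isomorphic_def join_pres_def meet_pres_def
    by blast
qed

section \<open>Unions of prefixes and prefix lengths\<close>

definition prefix_union :: "nat \<Rightarrow> (nat \<Rightarrow> nat \<Rightarrow> nat) \<Rightarrow> (nat \<Rightarrow> nat) \<Rightarrow> nat set" where
  "prefix_union k \<rho> x = (\<Union>i\<in>{1..k}. \<rho> i ` {1..x i})"

text \<open>The restricted lambda makes the result an extensional tuple, the form in which eligible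
  tuples are encoded.\<close>

definition prefix_lengths :: "nat \<Rightarrow> nat \<Rightarrow> (nat \<Rightarrow> nat \<Rightarrow> nat) \<Rightarrow> nat set \<Rightarrow> nat \<Rightarrow> nat" where
  "prefix_lengths n k \<rho> A = (\<lambda>i\<in>{1..k}. Max {j \<in> {0..n}. \<rho> i ` {1..j} \<subseteq> A})"

lemma prefix_lengths_mem:
  assumes "i \<in> {1..k}"
  shows "prefix_lengths n k \<rho> A i \<in> {j \<in> {0..n}. \<rho> i ` {1..j} \<subseteq> A}"
proof -
  \<comment> \<open>The empty prefix always qualifies, so the maximum is over a nonempty
    set.\<close>
  have "0 \<in> {j \<in> {0..n}. \<rho> i ` {1..j} \<subseteq> A}" by simp
  then have "Max {j \<in> {0..n}. \<rho> i ` {1..j} \<subseteq> A} \<in> {j \<in> {0..n}. \<rho> i ` {1..j} \<subseteq> A}"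
    by (intro Max_in) auto
  then show ?thesis
    using assms by (simp add: prefix_lengths_def)
qed

lemma prefix_lengths_le: "i \<in> {1..k} \<Longrightarrow> prefix_lengths n k \<rho> A i \<le> n"
  using prefix_lengths_mem[of i k n \<rho> A] by simp

lemma prefix_lengths_subset:
  "i \<in> {1..k} \<Longrightarrow> \<rho> i ` {1..prefix_lengths n k \<rho> A i} \<subseteq> A"
  using prefix_lengths_mem[of i k n \<rho> A] by simp

lemma le_prefix_lengths:
  "i \<in> {1..k} \<Longrightarrow> j \<le> n \<Longrightarrow> \<rho> i ` {1..j} \<subseteq> A \<Longrightarrow> j \<le> prefix_lengths n k \<rho> A i"
  unfolding prefix_lengths_def by (auto intro: Max_ge)

lemma prefix_lengths_extensional: "prefix_lengths n k \<rho> A \<in> {1..k} \<rightarrow>\<^sub>E {0..n}"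
  unfolding PiE_iff using prefix_lengths_le[of _ k n \<rho> A]
  by (simp add: prefix_lengths_def)

lemma prefix_lengths_mono:
  "A \<subseteq> B \<Longrightarrow> i \<in> {1..k} \<Longrightarrow> prefix_lengths n k \<rho> A i \<le> prefix_lengths n k \<rho> B i"
  by (intro le_prefix_lengths prefix_lengths_le order_trans[OF prefix_lengths_subset])

text \<open>Otherwise the prefix could be extended by one element, to a length still at most
  \<open>n\<close>, against maximality.\<close>

lemma prefix_lengths_next:
  assumes i: "i \<in> {1..k}" and lt: "prefix_lengths n k \<rho> A i < n"
  shows "\<rho> i (prefix_lengths n k \<rho> A i + 1) \<notin> A"
proof
  let ?m = "prefix_lengths n k \<rho> A i"
  assume "\<rho> i (?m + 1) \<in> A"
  moreover have "{1..?m + 1} = insert (?m + 1) {1..?m}" by auto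
  ultimately have "\<rho> i ` {1..?m + 1} \<subseteq> A"
    using prefix_lengths_subset[OF i, of \<rho> n A] by (simp only: image_insert insert_subset)
  then have "?m + 1 \<le> ?m"
    using le_prefix_lengths[OF i] lt by simp
  then show False by simp
qed

lemma prefix_union_mono:
  assumes "\<And>i. i \<in> {1..k} \<Longrightarrow> x i \<le> y i"
  shows "prefix_union k \<rho> x \<subseteq> prefix_union k \<rho> y"
  using assms unfolding prefix_union_def by (intro UN_mono image_mono) auto

lemma prefix_union_lengths_subset: "prefix_union k \<rho> (prefix_lengths n k \<rho> A) \<subseteq> A"
  unfolding prefix_union_def using prefix_lengths_subset by (intro UN_least)

text \<open>The prefix is at most as long as the maximal one taken from the same permutation. With
  \<open>A\<close> itself a prefix, this handles the generators.\<close>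

lemma prefix_subset_prefix_union_lengths:
  assumes "i \<in> {1..k}" "j \<le> n" "\<rho> i ` {1..j} \<subseteq> A"
  shows "\<rho> i ` {1..j} \<subseteq> prefix_union k \<rho> (prefix_lengths n k \<rho> A)"
proof -
  have "\<rho> i ` {1..j} \<subseteq> \<rho> i ` {1..prefix_lengths n k \<rho> A i}"
    using le_prefix_lengths[of i k j n \<rho> A] assms by (intro image_mono) simp
  then show ?thesis
    using assms(1) unfolding prefix_union_def by blast
qed

section \<open>The two carriers\<close>

lemma with_id_permutes:
  assumes "perm_vector n k \<sigma>" "i \<in> {1..k}"
  shows "with_id \<sigma> i permutes {1..n}"
  using assms by (auto simp: perm_vector_def with_id_def permutes_id)

text \<open>Inversion commutes with \<open>with_id\<close> because \<open>inv id = id\<close>, and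
  the double inverse in the right factor cancels.\<close>

lemma pi2_inv:
  assumes "perm_vector n k \<sigma>" "i \<in> {1..k}" "j \<in> {1..k}"
  shows "pi2 (\<lambda>i. inv (\<sigma> i)) i j = inv (with_id \<sigma> j) \<circ> with_id \<sigma> i"
proof -
  have "with_id (\<lambda>i. inv (\<sigma> i)) l = inv (with_id \<sigma> l)" for l
    by (simp add: with_id_def inv_id)
  then show ?thesis
    using permutes_inv_inv[OF with_id_permutes[OF assms(1,2)]] by (simp add: pi2_def)
qed

lemma eligible_iff_next_notin_prefix_union:
  assumes \<sigma>: "perm_vector n k \<sigma>"
  shows "eligible n k (\<lambda>i. inv (\<sigma> i)) x \<longleftrightarrow>
    x \<in> {1..k} \<rightarrow>\<^sub>E {0..n} \<and>
    (\<forall>i\<in>{1..k}. x i < n \<longrightarrow> with_id \<sigma> i (x i + 1) \<notin> prefix_union k (with_id \<sigma>) x)"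
proof -
  have "x j + 1 \<le> pi2 (\<lambda>i. inv (\<sigma> i)) i j (x i + 1) \<longleftrightarrow>
      with_id \<sigma> i (x i + 1) \<notin> with_id \<sigma> j ` {1..x j}"
    if "i \<in> {1..k}" "j \<in> {1..k}" "x i < n" for i j
  proof -
    have i: "with_id \<sigma> i permutes {1..n}" and j: "with_id \<sigma> j permutes {1..n}"
      using \<sigma> that with_id_permutes by blast+
    \<comment> \<open>\<open>b\<close> is the position at which the \<open>j\<close>-th permutation
      lists the element; the eligibility inequality says that this position comes after the first
      \<open>x j\<close>.\<close>
    define b where "b = inv (with_id \<sigma> j) (with_id \<sigma> i (x i + 1))"
    have b: "with_id \<sigma> j b = with_id \<sigma> i (x i + 1)"
      unfolding b_def using permutes_inverses[OF j] by simp
    \<comment> \<open>Here \<open>x i < n\<close> matters: it gives \<open>b \<ge> 1\<close>,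
      without which \<open>b \<notin> {1..x j}\<close> would not imply
      \<open>b > x j\<close>.\<close>
    have "with_id \<sigma> i (x i + 1) \<in> {1..n}"
      using permutes_in_image[OF i] that by simp
    then have "1 \<le> b"
      using permutes_in_image[OF j, of b] b by simp
    moreover have "with_id \<sigma> j b \<in> with_id \<sigma> j ` {1..x j} \<longleftrightarrow> b \<in> {1..x j}"
      using permutes_inj[OF j] by (rule inj_image_mem_iff)
    ultimately show ?thesis
      using pi2_inv[OF \<sigma> that(1,2)] b by (auto simp: b_def)
  qed
  then have "(\<forall>j\<in>{1..k}. x j + 1 \<le> pi2 (\<lambda>i. inv (\<sigma> i)) i j (x i + 1)) \<longleftrightarrow>
      with_id \<sigma> i (x i + 1) \<notin> prefix_union k (with_id \<sigma>) x"
    if "i \<in> {1..k}" "x i < n" for i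
    using that by (simp add: prefix_union_def)
  then show ?thesis
    unfolding eligible_def by meson
qed

text \<open>The next element of each permutation misses \<open>A\<close>, hence also the union of
  the maximal prefixes, which is contained in \<open>A\<close>. The argument works for an arbitrary
  set \<open>A\<close>.\<close>

lemma eligible_prefix_lengths:
  assumes "perm_vector n k \<sigma>"
  shows "eligible n k (\<lambda>i. inv (\<sigma> i)) (prefix_lengths n k (with_id \<sigma>) A)"
  unfolding eligible_iff_next_notin_prefix_union[OF assms]
proof (intro conjI ballI impI)
  let ?x = "prefix_lengths n k (with_id \<sigma>) A"
  fix i assume "i \<in> {1..k}" "?x i < n"
  then have "with_id \<sigma> i (?x i + 1) \<notin> A"
    using prefix_lengths_next[of i k n "with_id \<sigma>" A] by simp
  then show "with_id \<sigma> i (?x i + 1) \<notin> prefix_union k (with_id \<sigma>) ?x"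
    using prefix_union_lengths_subset[of k "with_id \<sigma>" n A] by (rule contra_subsetD[rotated])
qed (rule prefix_lengths_extensional)

text \<open>Each prefix of length \<open>x i\<close> lies in the union, so the maximal length is at
  least \<open>x i\<close>. A longer prefix would put the element at position \<open>x i + 1\<close>
  into the union, which eligibility forbids.\<close>

lemma prefix_lengths_prefix_union:
  assumes \<sigma>: "perm_vector n k \<sigma>" and x: "eligible n k (\<lambda>i. inv (\<sigma> i)) x"
  shows "prefix_lengths n k (with_id \<sigma>) (prefix_union k (with_id \<sigma>) x) = x"
proof (rule PiE_ext[OF prefix_lengths_extensional])
  let ?U = "prefix_union k (with_id \<sigma>) x"
  show xE: "x \<in> {1..k} \<rightarrow>\<^sub>E {0..n}"
    using x by (simp add: eligible_def)
  fix i assume i: "i \<in> {1..k}"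
  let ?m = "prefix_lengths n k (with_id \<sigma>) ?U i"
  have "x i \<le> n" using xE i by auto
  moreover have "with_id \<sigma> i ` {1..x i} \<subseteq> ?U"
    using i unfolding prefix_union_def by blast
  ultimately have "x i \<le> ?m"
    by (rule le_prefix_lengths[OF i])
  moreover have "\<not> x i < ?m"
  proof
    assume lt: "x i < ?m"
    then have "x i < n" using prefix_lengths_le[OF i] by (rule less_le_trans)
    then have "with_id \<sigma> i (x i + 1) \<notin> ?U"
      using x i unfolding eligible_iff_next_notin_prefix_union[OF \<sigma>] by blast
    moreover have "with_id \<sigma> i (x i + 1) \<in> with_id \<sigma> i ` {1..?m}"
      using lt by (intro imageI) simp
    ultimately show False
      using prefix_lengths_subset[OF i] by blast
  qed
  ultimately show "?m = x i" by simp
qed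

section \<open>The generated semilattice of sets\<close>

lemma join_subsemilattice_hull:
  assumes "G \<subseteq> Pow {1..n}"
  shows "join_subsemilattice n (join_subsemilattice n hull G)"
proof -
  \<comment> \<open>The power set is one of the families intersected by \<open>hull\<close>, which
    bounds the hull; closure under unions passes to intersections.\<close>
  have "join_subsemilattice n (Pow {1..n})"
    by (auto simp: join_subsemilattice_def)
  then have "join_subsemilattice n hull G \<subseteq> Pow {1..n}"
    using assms by (intro hull_minimal)
  then show ?thesis
    unfolding join_subsemilattice_def hull_def by blast
qed

lemma EJ_generators_subset:
  assumes "perm_vector n k \<sigma>"
  shows "EJ_generators n k \<sigma> \<subseteq> Pow {1..n}"
proof -
  have "with_id \<sigma> i ` {1..j} \<subseteq> {1..n}" if "i \<in> {1..k}" "j \<in> {0..n}" for i j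
  proof -
    have "with_id \<sigma> i ` {1..j} \<subseteq> with_id \<sigma> i ` {1..n}"
      using that by (intro image_mono) auto
    then show ?thesis
      using permutes_image[OF with_id_permutes[OF assms that(1)]] by simp
  qed
  then show ?thesis
    unfolding EJ_generators_def by blast
qed

lemma EJ_Un_closed:
  assumes "perm_vector n k \<sigma>" "A \<in> carrier (L_EJ n k \<sigma>)" "B \<in> carrier (L_EJ n k \<sigma>)"
  shows "A \<union> B \<in> carrier (L_EJ n k \<sigma>)"
  using join_subsemilattice_hull[OF EJ_generators_subset[OF assms(1)]] assms(2,3)
  by (simp add: L_EJ_def join_subsemilattice_def)

lemma prefix_union_in_EJ:
  assumes \<sigma>: "perm_vector n k \<sigma>" and k: "1 \<le> k"
    and x: "\<And>i. i \<in> {1..k} \<Longrightarrow> x i \<le> n"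
  shows "prefix_union k (with_id \<sigma>) x \<in> carrier (L_EJ n k \<sigma>)"
proof -
  have gen: "with_id \<sigma> i ` {1..x i} \<in> carrier (L_EJ n k \<sigma>)" if "i \<in> {1..k}" for i
    unfolding L_EJ_def EJ_generators_def using x that by (auto intro!: hull_inc)
  \<comment> \<open>Closure is under binary unions, hence the induction over nonempty finite index
    sets; \<open>1 \<le> k\<close> makes \<open>{1..k}\<close> such a set.\<close>
  have "(\<Union>i\<in>I. with_id \<sigma> i ` {1..x i}) \<in> carrier (L_EJ n k \<sigma>)"
    if "finite I" "I \<noteq> {}" "I \<subseteq> {1..k}" for I
    using that
  proof (induction rule: finite_ne_induct)
    case (singleton i)
    then show ?case using gen by simp
  next
    case (insert i I)
    then show ?case using gen EJ_Un_closed[OF \<sigma>] by simp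
  qed
  then show ?thesis
    unfolding prefix_union_def using k by simp
qed

text \<open>One inclusion holds for all sets. For the other, the sets \<open>A\<close> with
  \<open>A \<subseteq> ?c A\<close> contain the generators and, as \<open>?c\<close> is monotone,
  are closed under unions: \<open>A \<union> B \<subseteq> ?c A \<union> ?c B \<subseteq> ?c (A
  \<union> B)\<close>. So they include the whole hull.\<close>

lemma prefix_union_prefix_lengths:
  assumes \<sigma>: "perm_vector n k \<sigma>" and A: "A \<in> carrier (L_EJ n k \<sigma>)"
  shows "prefix_union k (with_id \<sigma>) (prefix_lengths n k (with_id \<sigma>) A) = A"
proof -
  let ?c = "\<lambda>A. prefix_union k (with_id \<sigma>) (prefix_lengths n k (with_id \<sigma>) A)"
  let ?F = "{A \<in> Pow {1..n}. A \<subseteq> ?c A}"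
  have mono: "?c A \<subseteq> ?c B" if "A \<subseteq> B" for A B
    using that by (intro prefix_union_mono prefix_lengths_mono)
  have "join_subsemilattice n ?F"
    using mono[OF Un_upper1] mono[OF Un_upper2] unfolding join_subsemilattice_def
    by blast
  moreover have "EJ_generators n k \<sigma> \<subseteq> ?F"
  proof
    fix G assume G: "G \<in> EJ_generators n k \<sigma>"
    then obtain i j where "G = with_id \<sigma> i ` {1..j}" "i \<in> {1..k}" "j \<le> n"
      by (auto simp: EJ_generators_def)
    then have "G \<subseteq> ?c G"
      using prefix_subset_prefix_union_lengths[of i k j n "with_id \<sigma>" G] by simp
    then show "G \<in> ?F"
      using G EJ_generators_subset[OF \<sigma>] by blast
  qed
  ultimately have "carrier (L_EJ n k \<sigma>) \<subseteq> ?F"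
    unfolding L_EJ_def by (simp add: hull_minimal)
  then show ?thesis
    using A prefix_union_lengths_subset by (intro equalityI) auto
qed

section \<open>Order structure of both sides and the isomorphism\<close>

lemma lattice_L_EJ:
  assumes \<sigma>: "perm_vector n k \<sigma>" and k: "1 \<le> k"
  shows "lattice (L_EJ n k \<sigma>)"
proof -
  let ?L = "L_EJ n k \<sigma>"
  have le: "A \<sqsubseteq>\<^bsub>?L\<^esub> B \<longleftrightarrow> A \<subseteq> B" and eq: "A .=\<^bsub>?L\<^esub> B \<longleftrightarrow> A = B" for A B
    by (simp_all add: L_EJ_def)
  show ?thesis
  proof
    fix A B assume A: "A \<in> carrier ?L" and B: "B \<in> carrier ?L"
    have "least ?L (A \<union> B) (Upper ?L {A, B})"
      using A B EJ_Un_closed[OF \<sigma> A B] by (auto simp: least_def Upper_def le)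
    then show "\<exists>s. least ?L s (Upper ?L {A, B})" ..
    let ?f = "prefix_lengths n k (with_id \<sigma>)" and ?U = "prefix_union k (with_id \<sigma>)"
    \<comment> \<open>The intersection may fall outside the carrier, so the meet is the union of all
      prefixes inside it. A member \<open>C\<close> below both sets equals \<open>?U (?f C)\<close>,
      and monotonicity puts it below this candidate.\<close>
    have "?U (?f (A \<inter> B)) \<in> carrier ?L"
      by (intro prefix_union_in_EJ[OF \<sigma> k] prefix_lengths_le)
    moreover have "?U (?f (A \<inter> B)) \<subseteq> A \<inter> B"
      by (rule prefix_union_lengths_subset)
    moreover have "C \<subseteq> ?U (?f (A \<inter> B))" if "C \<in> carrier ?L" "C \<subseteq> A \<inter> B" for C
    proof -
      have "?U (?f C) \<subseteq> ?U (?f (A \<inter> B))"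
        using that(2) by (intro prefix_union_mono prefix_lengths_mono)
      then show ?thesis
        using prefix_union_prefix_lengths[OF \<sigma> that(1)] by simp
    qed
    ultimately have "greatest ?L (?U (?f (A \<inter> B))) (Lower ?L {A, B})"
      using A B by (auto simp: greatest_def Lower_def le)
    then show "\<exists>s. greatest ?L s (Lower ?L {A, B})" ..
  qed (auto simp: le eq fun_eq_iff)
qed

lemma partial_order_L_C: "partial_order (L_C n k \<pi>)"
proof
  fix x y
  assume "x \<sqsubseteq>\<^bsub>L_C n k \<pi>\<^esub> y" "y \<sqsubseteq>\<^bsub>L_C n k \<pi>\<^esub> x"
    and "x \<in> carrier (L_C n k \<pi>)" "y \<in> carrier (L_C n k \<pi>)"
  then have "x \<in> {1..k} \<rightarrow>\<^sub>E {0..n}" "y \<in> {1..k} \<rightarrow>\<^sub>E {0..n}" "\<forall>i\<in>{1..k}. x i = y i"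
    by (auto simp: L_C_def eligible_def intro: antisym)
  \<comment> \<open>The order sees only the indices in \<open>{1..k}\<close>; extensionality settles
    the others.\<close>
  then have "x = y" by (blast intro: PiE_ext)
  then show "x .=\<^bsub>L_C n k \<pi>\<^esub> y" by (simp add: L_C_def)
qed (auto simp: L_C_def intro: order_trans)

theorem proposition1:
  fixes n k :: nat and \<sigma> :: "nat \<Rightarrow> nat \<Rightarrow> nat"
  assumes "n \<ge> 1" and "k \<ge> 2"
    and "perm_vector n k \<sigma>"
  shows "lattice_isomorphic (L_EJ n k \<sigma>) (L_C n k (\<lambda>i. inv (\<sigma> i)))"
proof (rule order_iso_imp_lattice_isomorphic)
  note \<sigma> = assms(3)
  have k: "1 \<le> k" using assms(2) by simp
  let ?L = "L_EJ n k \<sigma>" and ?M = "L_C n k (\<lambda>i. inv (\<sigma> i))"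
  let ?f = "prefix_lengths n k (with_id \<sigma>)" and ?U = "prefix_union k (with_id \<sigma>)"
  show "lattice ?L" by (rule lattice_L_EJ[OF \<sigma> k])
  show "partial_order ?M" by (rule partial_order_L_C)
  show "bij_betw ?f (carrier ?L) (carrier ?M)"
  proof (rule bij_betw_byWitness[where f' = ?U])
    show "\<forall>A\<in>carrier ?L. ?U (?f A) = A"
      using prefix_union_prefix_lengths[OF \<sigma>] by blast
    show "\<forall>x\<in>carrier ?M. ?f (?U x) = x"
      using prefix_lengths_prefix_union[OF \<sigma>] by (simp add: L_C_def)
    show "?f ` carrier ?L \<subseteq> carrier ?M"
      using eligible_prefix_lengths[OF \<sigma>] by (auto simp: L_C_def)
    show "?U ` carrier ?M \<subseteq> carrier ?L"
    proof (rule image_subsetI, rule prefix_union_in_EJ[OF \<sigma> k])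
      fix x i assume "x \<in> carrier ?M" "i \<in> {1..k}"
      then show "x i \<le> n" by (auto simp: L_C_def eligible_def)
    qed
  qed
  fix A B assume A: "A \<in> carrier ?L" and B: "B \<in> carrier ?L"
  have "?f A \<sqsubseteq>\<^bsub>?M\<^esub> ?f B \<longleftrightarrow> (\<forall>i\<in>{1..k}. ?f A i \<le> ?f B i)"
    by (simp add: L_C_def)
  also have "\<dots> \<longleftrightarrow> A \<subseteq> B"
  proof
    assume "\<forall>i\<in>{1..k}. ?f A i \<le> ?f B i"
    \<comment> \<open>The order is reflected because \<open>?U\<close> is monotone and recovers
      \<open>A\<close> and \<open>B\<close> from their prefix lengths.\<close>
    then have "?U (?f A) \<subseteq> ?U (?f B)" by (intro prefix_union_mono) blast
    then show "A \<subseteq> B"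
      using prefix_union_prefix_lengths[OF \<sigma>] A B by simp
  qed (auto intro: prefix_lengths_mono)
  finally show "?f A \<sqsubseteq>\<^bsub>?M\<^esub> ?f B \<longleftrightarrow> A \<sqsubseteq>\<^bsub>?L\<^esub> B"
    by (simp add: L_EJ_def)
qed

end
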